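(* For every integer $n\ge 1$, the Bergman projection $P$ on the polydisc $\mathbb{D}^n$ is of weak-type $L(\log^+L)^{n-1}$: there is a constant $C>0$ such that for all $f\in L(\log^+L)^{n-1}(\mathbb{D}^n)$ and all $\lambda>0$, $$\left|\{z\in\mathbb{D}^n : |P(f)(z)|>\lambda\}\right| \le \frac{C\,\|f\|_{L(\log^+L)^{n-1}(\mathbb{D}^n)}}{\lambda}.$$
   Context: $\mathbb{D}$ is the unit disc, $dV$ Lebesgue measure, $|U|$ Lebesgue measure of $U$. The Bergman projection on $\mathbb{D}^n$ is $P(f)(z)=\int_{\mathbb{D}^n}\prod_{j=1}^n\frac{1}{\pi(1-z_j\bar w_j)^2}f(w)\,dV(w)$. Let $\log^+x=\max\{0,\log x\}$ for $x>0$, $\log^+0=0$. For integer $k\ge0$, $L(\log^+L)^k(\Omega)$ is the Orlicz space of measurable $f$ with finite Luxemburg norm $\|f\|_{L(\log^+L)^k(\Omega)}=\inf\{\lambda>0:\int_\Omega |f/\lambda|(\log^+|f/\lambda|)^k\,dV\le 1\}$ (so $k=0$ gives $L^1$). *)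

theory Defs
  imports "HOL-Analysis.Analysis"
begin

definition polydisc :: "(complex ^ 'n) set" where
  "polydisc = {z. \<forall>j. norm (z $ j) < 1}"

definition log_plus :: "real \<Rightarrow> real" where
  "log_plus x = (if x > 0 then max 0 (ln x) else 0)"

text \<open>Young function t (log^+ t)^k (with (log^+ t)^0 = 1, so k = 0 gives t).\<close>
definition Phi_LlogL :: "nat \<Rightarrow> real \<Rightarrow> real" where
  "Phi_LlogL k t = t * (log_plus t) ^ k"

definition LlogL_modular ::
  "nat \<Rightarrow> ('a::euclidean_space) set \<Rightarrow> ('a \<Rightarrow> complex) \<Rightarrow> real \<Rightarrow> ennreal" where
  "LlogL_modular k \<Omega> f lam =
     (\<integral>\<^sup>+ x. ennreal (Phi_LlogL k (norm (f x) / lam)) * indicator \<Omega> x \<partial>lebesgue)"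

definition LlogL_norm ::
  "nat \<Rightarrow> ('a::euclidean_space) set \<Rightarrow> ('a \<Rightarrow> complex) \<Rightarrow> real" where
  "LlogL_norm k \<Omega> f = Inf {lam. lam > 0 \<and> LlogL_modular k \<Omega> f lam \<le> 1}"

definition LlogL_space ::
  "nat \<Rightarrow> ('a::euclidean_space) set \<Rightarrow> ('a \<Rightarrow> complex) set" where
  "LlogL_space k \<Omega> =
     {f. set_borel_measurable lebesgue \<Omega> f \<and>
         (\<exists>lam. lam > 0 \<and> LlogL_modular k \<Omega> f lam \<le> 1)}"

definition bergman_proj :: "((complex ^ 'n) \<Rightarrow> complex) \<Rightarrow> (complex ^ 'n) \<Rightarrow> complex" where
  "bergman_proj f z =
     (LINT w : polydisc | lebesgue.
        (\<Prod>j\<in>UNIV. 1 / (complex_of_real pi * (1 - z $ j * cnj (w $ j))^2)) * f w)"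

end

theory Submission
  imports Defs
begin

text \<open>Let \<open>d(z) = (1 - |z|\<^sup>2)/2\<close>. On the disc \<open>|1 - z w\<^sup>*|\<close>, with \<open>w\<^sup>*\<close> the conjugate
  of \<open>w\<close>, dominates both \<open>d(z)\<close> and \<open>|z - w|\<close>, so it suffices to treat the positive operator
  \<open>T\<close> with kernel \<open>|1 - z w\<^sup>*|\<^sup>-\<^sup>2\<close>. In one variable, if \<open>T f(z) > s\<close> then for some scale
  \<open>R = 4\<^sup>j d(z)\<close> the mass of \<open>f\<close> in the ball \<open>B(z,R)\<close> exceeds \<open>c s 2\<^sup>-\<^sup>j R\<^sup>2\<close>. The Vitali covering
  lemma covers the set of such \<open>z\<close> by the parts of balls of radius \<open>5R\<close> lying within
  distance about \<open>4\<^sup>-\<^sup>j R\<close> of the circle; these have area of order \<open>4\<^sup>-\<^sup>j R\<^sup>2\<close>. Summing first over the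
  disjoint balls and then over \<open>j\<close> gives weak type (1,1), without any \<open>L\<^sup>2\<close> theory.

  In several variables, weak type (1,1) is applied in a single coordinate; integrating over the
  others leaves the integral of \<open>|f|\<close> against \<open>n - 1\<close> factors \<open>T 1(w\<^sub>i)\<close>. These grow
  logarithmically in \<open>1/d(w\<^sub>i)\<close>, hence are exponentially integrable, and Young's inequality for
  \<open>t (log\<^sup>+ t)\<^sup>n\<^sup>-\<^sup>1\<close> bounds the integral.\<close>

section \<open>Area near the unit circle\<close>

text \<open>A coordinate box in the plane is a product of two intervals, and box areas determine
  \<open>lborel\<close>. This makes Tonelli available for planar areas.\<close>

lemma lborel_complex_eq:
  "(lborel :: complex measure) = distr (lborel \<Otimes>\<^sub>M lborel) borel (\<lambda>(x, y). Complex x y)"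
proof (rule lborel_eqI)
  have [measurable]: "(\<lambda>(x, y). Complex x y) \<in> borel_measurable (borel \<Otimes>\<^sub>M borel)"
    by (subst borel_prod, rule borel_measurable_continuous_onI)
       (auto simp: case_prod_beta Complex_eq intro!: continuous_intros)
  fix l u :: complex
  assume le: "\<And>b. b \<in> Basis \<Longrightarrow> l \<bullet> b \<le> u \<bullet> b"
  have "(\<lambda>(x, y). Complex x y) -` box l u = {Re l<..<Re u} \<times> {Im l<..<Im u}"
    by (auto simp: box_def Basis_complex_def)
  with le[of 1] le[of \<i>]
  show "emeasure (distr (lborel \<Otimes>\<^sub>M lborel) borel (\<lambda>(x, y). Complex x y)) (box l u)
      = ennreal (\<Prod>b\<in>Basis. (u - l) \<bullet> b)"
    by (simp add: emeasure_distr space_pair_measure lborel.emeasure_pair_measure_Times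
        Basis_complex_def ennreal_mult)
qed simp

lemma measurable_Complex [measurable (raw)]:
  "f \<in> borel_measurable M \<Longrightarrow> g \<in> borel_measurable M \<Longrightarrow>
    (\<lambda>x. Complex (f x) (g x)) \<in> borel_measurable M"
  by (rule borel_measurable_continuous_Pair)
     (auto simp: Complex_eq intro!: continuous_intros)

text \<open>Both orders of integration are kept: horizontal lines cross the circle transversally
  near the real axis, vertical lines near the imaginary axis.\<close>

lemma emeasure_complex_slices:
  assumes [measurable]: "A \<in> sets borel"
  shows "emeasure lborel A = (\<integral>\<^sup>+y. emeasure lborel {x. Complex x y \<in> A} \<partial>lborel)"
    and "emeasure lborel A = (\<integral>\<^sup>+x. emeasure lborel {y. Complex x y \<in> A} \<partial>lborel)"
proof -
  have m: "(\<lambda>(x, y). Complex x y) \<in> borel_measurable (lborel \<Otimes>\<^sub>M lborel)"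
    by measurable
  define B where "B = (\<lambda>(x, y). Complex x y) -` A \<inter> space (lborel \<Otimes>\<^sub>M lborel)"
  have B: "B \<in> sets (lborel \<Otimes>\<^sub>M lborel)"
    unfolding B_def using m by (rule measurable_sets) simp
  have eq: "emeasure lborel A = emeasure (lborel \<Otimes>\<^sub>M lborel) B"
    unfolding B_def by (subst lborel_complex_eq, subst emeasure_distr[OF m]) simp_all
  show "emeasure lborel A = (\<integral>\<^sup>+y. emeasure lborel {x. Complex x y \<in> A} \<partial>lborel)"
    unfolding eq lborel_pair.emeasure_pair_measure_alt2[OF B]
    by (simp add: B_def space_pair_measure vimage_def)
  show "emeasure lborel A = (\<integral>\<^sup>+x. emeasure lborel {y. Complex x y \<in> A} \<partial>lborel)"
    unfolding eq lborel.emeasure_pair_measure_alt[OF B]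
    by (simp add: B_def space_pair_measure vimage_def)
qed

lemma emeasure_lborel_le_of_diameter:
  fixes X :: "real set"
  assumes "\<And>x x'. x \<in> X \<Longrightarrow> x' \<in> X \<Longrightarrow> \<bar>x - x'\<bar> \<le> t"
  shows "emeasure lborel X \<le> ennreal (2 * t)"
proof (cases "X = {}")
  case False
  then obtain x0 where x0: "x0 \<in> X" by auto
  have "X \<subseteq> {x0 - t..x0 + t}"
    using assms[OF x0] by (force simp: abs_le_iff)
  then have "emeasure lborel X \<le> emeasure lborel {x0 - t..x0 + t}"
    by (intro emeasure_mono) auto
  also have "\<dots> = ennreal (2 * t)"
    using assms[OF x0 x0] by simp
  finally show ?thesis .
qed simp

text \<open>Every point of \<open>X\<close> has absolute value at least 1/2, so squaring does not
  contract distances on either half-line, while the squares stay in an interval of length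
  \<open>2 * \<delta>\<close>. Each half of \<open>X\<close> thus has diameter at most
  \<open>2 * \<delta>\<close>.\<close>

lemma emeasure_annulus_slice_le:
  fixes y \<delta> :: real and X :: "real set"
  assumes X: "\<And>x. x \<in> X \<Longrightarrow> x\<^sup>2 + y\<^sup>2 < 1 \<and> 1 - 2 * \<delta> \<le> x\<^sup>2 + y\<^sup>2 \<and> y\<^sup>2 \<le> x\<^sup>2"
    and \<delta>: "0 < \<delta>" "\<delta> \<le> 1/4" and [measurable]: "X \<in> sets borel"
  shows "emeasure lborel X \<le> ennreal (8 * \<delta>)"
proof -
  have half: "1/2 \<le> \<bar>x\<bar>" if "x \<in> X" for x
  proof -
    have "(1/2)\<^sup>2 \<le> x\<^sup>2" using X[OF that] \<delta> by (simp add: power2_eq_square)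
    then show ?thesis using abs_le_square_iff[of "1/2" x] by simp
  qed
  have dist: "\<bar>x - x'\<bar> \<le> 2 * \<delta>" if "x \<in> X" "x' \<in> X" "x > 0 \<longleftrightarrow> x' > 0" for x x'
  proof -
    have "\<bar>x - x'\<bar> * 1 \<le> \<bar>x - x'\<bar> * \<bar>x + x'\<bar>"
      using half[OF that(1)] half[OF that(2)] that(3) by (intro mult_left_mono) auto
    also have "\<dots> = \<bar>x\<^sup>2 - x'\<^sup>2\<bar>"
      by (simp add: abs_mult[symmetric] power2_eq_square algebra_simps)
    also have "\<dots> \<le> 2 * \<delta>"
      using X[OF that(1)] X[OF that(2)] by auto
    finally show ?thesis by simp
  qed
  have "emeasure lborel X = emeasure lborel (X \<inter> {0<..} \<union> X \<inter> {..0})"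
    by (rule arg_cong[where f = "emeasure lborel"]) auto
  also have "\<dots> \<le> emeasure lborel (X \<inter> {0<..}) + emeasure lborel (X \<inter> {..0})"
    by (intro emeasure_subadditive) auto
  also have "\<dots> \<le> ennreal (2 * (2 * \<delta>)) + ennreal (2 * (2 * \<delta>))"
    by (intro add_mono emeasure_lborel_le_of_diameter dist) auto
  also have "\<dots> = ennreal (8 * \<delta>)"
    using \<delta> by (simp flip: ennreal_plus)
  finally show ?thesis .
qed

text \<open>Comparable to the distance from z to the unit circle, but polynomial in the coordinates.\<close>
definition bdist :: "complex \<Rightarrow> real" where
  "bdist z = (1 - (norm z)\<^sup>2) / 2"

lemma measurable_bdist [measurable]: "bdist \<in> borel_measurable borel"
  unfolding bdist_def by measurable

lemma bdist_pos: "norm z < 1 \<Longrightarrow> 0 < bdist z"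
  by (simp add: bdist_def abs_square_less_1)

lemma bdist_le: "bdist z \<le> 1/2"
  by (simp add: bdist_def)

definition near_circle :: "complex \<Rightarrow> real \<Rightarrow> real \<Rightarrow> complex set" where
  "near_circle a r \<delta> = {z. norm z < 1 \<and> dist a z < r \<and> bdist z \<le> \<delta>}"

lemma near_circle_sets [measurable]: "near_circle a r \<delta> \<in> sets borel"
  unfolding near_circle_def by measurable

text \<open>The two diagonals cut the region into \<open>A\<close> and \<open>B\<close>. Their
  slices transversal to the circle have measure at most \<open>8 * \<delta>\<close> and are indexed
  by an interval of length \<open>2 * r\<close>. For \<open>\<delta>\<close> above 1/4 the square
  around the disc has area 4, and this case fixes the constant 64.\<close>

lemma emeasure_near_circle_le:
  assumes \<delta>: "0 < \<delta>" "\<delta> \<le> r"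
  shows "emeasure lborel (near_circle a r \<delta>) \<le> ennreal (64 * r * \<delta>)"
proof (cases "\<delta> \<le> 1/4")
  case False
  have "emeasure lborel (near_circle a r \<delta>) \<le> emeasure lborel (box (Complex (-1) (-1)) (Complex 1 1))"
  proof (intro emeasure_mono)
    have "\<bar>Re x\<bar> < 1 \<and> \<bar>Im x\<bar> < 1" if "norm x < 1" for x
      using abs_Re_le_cmod[of x] abs_Im_le_cmod[of x] that by linarith
    then show "near_circle a r \<delta> \<subseteq> box (Complex (-1) (-1)) (Complex 1 1)"
      by (auto simp: near_circle_def box_def Basis_complex_def abs_less_iff)
  qed simp
  also have "\<dots> = ennreal 4"
    by (subst emeasure_lborel_box) (auto simp: Basis_complex_def)
  also have "4 \<le> 64 * r * \<delta>"
    using mult_mono[of "1/4" r "1/4" \<delta>] False \<delta> by (simp add: mult_ac)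
  then have "ennreal 4 \<le> ennreal (64 * r * \<delta>)"
    by (rule ennreal_leI)
  finally show ?thesis .
next
  case True
  define S where "S = near_circle a r \<delta>"
  define A where "A = S \<inter> {z. (Im z)\<^sup>2 \<le> (Re z)\<^sup>2}"
  define B where "B = S \<inter> {z. (Re z)\<^sup>2 \<le> (Im z)\<^sup>2}"
  have [measurable]: "A \<in> sets borel" "B \<in> sets borel"
    unfolding A_def B_def S_def by measurable
  have bound: "z \<in> S \<Longrightarrow> (Re z)\<^sup>2 + (Im z)\<^sup>2 < 1 \<and> 1 - 2 * \<delta> \<le> (Re z)\<^sup>2 + (Im z)\<^sup>2 \<and>
      \<bar>Re z - Re a\<bar> < r \<and> \<bar>Im z - Im a\<bar> < r" for z
    using abs_Re_le_cmod[of "z - a"] abs_Im_le_cmod[of "z - a"]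
    unfolding cmod_power2[symmetric]
    by (auto simp: S_def near_circle_def dist_norm norm_minus_commute bdist_def field_simps
        abs_square_less_1)
  have int: "(\<integral>\<^sup>+y. ennreal (8 * \<delta>) * indicator {c - r<..<c + r} y \<partial>lborel) = ennreal (16 * r * \<delta>)" for c
    using \<delta> by (simp add: nn_integral_cmult_indicator mult_ac flip: ennreal_mult)
  have "emeasure lborel A \<le> (\<integral>\<^sup>+y. ennreal (8 * \<delta>) * indicator {Im a - r<..<Im a + r} y \<partial>lborel)"
  proof (subst emeasure_complex_slices(1), simp, intro nn_integral_mono)
    fix y
    have meas: "{x. Complex x y \<in> A} \<in> sets borel" by measurable
    show "emeasure lborel {x. Complex x y \<in> A} \<le> ennreal (8 * \<delta>) * indicator {Im a - r<..<Im a + r} y"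
    proof (cases "y \<in> {Im a - r<..<Im a + r}")
      case True
      have "emeasure lborel {x. Complex x y \<in> A} \<le> ennreal (8 * \<delta>)"
        using bound[of "Complex x y" for x y] \<open>\<delta> \<le> 1/4\<close> \<delta>
        by (intro emeasure_annulus_slice_le[OF _ _ _ meas, where y = y]) (auto simp: A_def)
      then show ?thesis using True by simp
    next
      case False
      then have "{x. Complex x y \<in> A} = {}"
        using bound by (fastforce simp: A_def abs_less_iff)
      then show ?thesis by simp
    qed
  qed
  \<comment> \<open>The mirror image of the previous bound: on \<open>B\<close> the vertical slices
    are the transversal ones.\<close>
  moreover have "emeasure lborel B \<le> (\<integral>\<^sup>+x. ennreal (8 * \<delta>) * indicator {Re a - r<..<Re a + r} x \<partial>lborel)"
  proof (subst emeasure_complex_slices(2), simp, intro nn_integral_mono)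
    fix x
    have meas: "{y. Complex x y \<in> B} \<in> sets borel" by measurable
    show "emeasure lborel {y. Complex x y \<in> B} \<le> ennreal (8 * \<delta>) * indicator {Re a - r<..<Re a + r} x"
    proof (cases "x \<in> {Re a - r<..<Re a + r}")
      case True
      have "emeasure lborel {y. Complex x y \<in> B} \<le> ennreal (8 * \<delta>)"
        using bound[of "Complex x y" for x y] \<open>\<delta> \<le> 1/4\<close> \<delta>
        by (intro emeasure_annulus_slice_le[OF _ _ _ meas, where y = x]) (fastforce simp: B_def add.commute)+
      then show ?thesis using True by simp
    next
      case False
      then have "{y. Complex x y \<in> B} = {}"
        using bound by (fastforce simp: B_def abs_less_iff)
      then show ?thesis by simp
    qed
  qed
  ultimately have "emeasure lborel A + emeasure lborel B \<le> ennreal (16 * r * \<delta>) + ennreal (16 * r * \<delta>)"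
    unfolding int by (rule add_mono)
  also have "\<dots> \<le> ennreal (64 * r * \<delta>)"
    using \<delta> by (simp flip: ennreal_plus)
  finally have le: "emeasure lborel A + emeasure lborel B \<le> ennreal (64 * r * \<delta>)" .
  have "S = A \<union> B"
    by (auto simp: A_def B_def)
  then have "emeasure lborel S \<le> emeasure lborel A + emeasure lborel B"
    by (simp add: emeasure_subadditive)
  with le show ?thesis unfolding S_def by (rule order_trans[rotated])
qed

section \<open>Weak type (1,1) in one variable\<close>

text \<open>The absolute value of the one-variable Bergman kernel without its factor 1/pi, extended
  by zero off the bidisc. Integrals can then run over the whole plane, and values in
  \<open>ennreal\<close> spare integrability conditions.\<close>

definition kern :: "complex \<Rightarrow> complex \<Rightarrow> ennreal" where
  "kern z w = (if norm z < 1 \<and> norm w < 1 then ennreal (1 / (norm (1 - z * cnj w))\<^sup>2) else 0)"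

lemma kern_commute: "kern z w = kern w z"
proof -
  have "norm (1 - z * cnj w) = norm (cnj (1 - z * cnj w))"
    by (rule complex_mod_cnj[symmetric])
  then show ?thesis
    by (simp add: kern_def mult.commute)
qed

lemma borel_measurable_cnj [measurable]: "cnj \<in> borel_measurable borel"
  by (intro borel_measurable_continuous_onI continuous_intros)

lemma measurable_kern [measurable (raw)]:
  assumes [measurable]: "f \<in> borel_measurable M" "g \<in> borel_measurable M"
  shows "(\<lambda>x. kern (f x) (g x)) \<in> borel_measurable M"
proof -
  have [measurable]: "(\<lambda>x. cnj (g x)) \<in> borel_measurable M"
    by (rule measurable_compose[OF assms(2) borel_measurable_cnj])
  show ?thesis unfolding kern_def by measurable
qed

text \<open>The first bound goes through \<open>1 - norm z\<close>, which exceeds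
  \<open>bdist z\<close> by half a square. For the second, the square of
  \<open>norm (1 - z * cnj w)\<close> is the square of \<open>norm (z - w)\<close> plus a product of
  two nonnegative factors.\<close>

lemma norm_one_minus_mult_cnj_ge:
  assumes "norm z < 1" "norm w < 1"
  shows "bdist z \<le> norm (1 - z * cnj w)" and "norm (z - w) \<le> norm (1 - z * cnj w)"
proof -
  have "bdist z \<le> 1 - norm z"
    using assms zero_le_power2[of "1 - norm z"]
    by (simp add: bdist_def power2_eq_square algebra_simps diff_divide_distrib)
  also have "\<dots> \<le> 1 - norm z * norm w"
    using assms mult_left_le[of "norm w" "norm z"] by simp
  also have "\<dots> \<le> norm (1 - z * cnj w)"
    using norm_triangle_ineq2[of 1 "z * cnj w"] by (simp add: norm_mult)
  finally show "bdist z \<le> norm (1 - z * cnj w)" .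
  have "(norm (1 - z * cnj w))\<^sup>2 = (norm (z - w))\<^sup>2 + (1 - (norm z)\<^sup>2) * (1 - (norm w)\<^sup>2)"
    unfolding cmod_power2 by (simp add: power2_eq_square algebra_simps)
  moreover have "0 \<le> (1 - (norm z)\<^sup>2) * (1 - (norm w)\<^sup>2)"
    using assms by (intro mult_nonneg_nonneg) (auto simp: abs_square_le_1)
  ultimately have "(norm (z - w))\<^sup>2 \<le> (norm (1 - z * cnj w))\<^sup>2"
    by linarith
  then show "norm (z - w) \<le> norm (1 - z * cnj w)"
    by (rule power2_le_imp_le) simp
qed

text \<open>Take the smallest ball in the family that contains \<open>w\<close>. Its radius is at
  most four times a lower bound for \<open>norm (1 - z * cnj w)\<close>, whence the constant
  16.\<close>

lemma kern_le_scale: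
  assumes z: "norm z < 1" and w: "norm w < 1"
  obtains j :: nat where "4 ^ j * bdist z \<le> 8" "w \<in> cball z (4 ^ j * bdist z)"
    "kern z w \<le> ennreal (16 / (4 ^ j * bdist z)\<^sup>2)"
proof -
  define d where "d = bdist z"
  have d: "0 < d" "d \<le> 1/2"
    using z bdist_le[of z] by (auto simp: d_def bdist_pos)
  have zw: "dist z w < 2"
    using z w dist_triangle[of z w 0] by (simp add: dist_commute)
  obtain j0 where "dist z w / d < 4 ^ j0"
    using real_arch_pow[of 4 "dist z w / d"] by auto
  then have j0: "dist z w \<le> 4 ^ j0 * d"
    using d by (simp add: field_simps)
  define j where "j = (LEAST j. dist z w \<le> 4 ^ j * d)"
  have j: "dist z w \<le> 4 ^ j * d"
    unfolding j_def using j0 by (rule LeastI)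
  have small: "i < j \<Longrightarrow> 4 ^ i * d < dist z w" for i
    unfolding j_def using not_less_Least by fastforce
  \<comment> \<open>\<open>\<rho>\<close> is \<open>d\<close> if the smallest radius already
    suffices, and otherwise \<open>dist z w\<close>, which exceeds a quarter of the radius by
    minimality of \<open>j\<close>. The bound 8 comes from \<open>dist z w < 2\<close>.\<close>
  have "\<exists>\<rho>>0. \<rho> \<le> norm (1 - z * cnj w) \<and> 4 ^ j * d \<le> 4 * \<rho> \<and> 4 ^ j * d \<le> 8"
  proof (cases j)
    case 0
    then show ?thesis
      using d norm_one_minus_mult_cnj_ge(1)[OF z w] by (intro exI[of _ d]) (auto simp: d_def)
  next
    case (Suc i)
    then have "4 ^ i * d < dist z w"
      using small[of i] by simp
    moreover have "0 < 4 ^ i * d" using d by simp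
    moreover have "4 ^ j * d = 4 * (4 ^ i * d)" using Suc by simp
    ultimately have "dist z w > 0" "4 ^ j * d \<le> 4 * dist z w" "4 ^ j * d \<le> 8"
      using zw by linarith+
    then show ?thesis
      using norm_one_minus_mult_cnj_ge(2)[OF z w] by (intro exI[of _ "dist z w"]) (auto simp: dist_norm)
  qed
  then obtain \<rho> where \<rho>: "\<rho> > 0" "\<rho> \<le> norm (1 - z * cnj w)" "4 ^ j * d \<le> 4 * \<rho>" "4 ^ j * d \<le> 8"
    by auto
  have "1 / (norm (1 - z * cnj w))\<^sup>2 \<le> 1 / \<rho>\<^sup>2"
    using \<rho> by (intro frac_le power_mono) auto
  also have "\<dots> = 16 / (4 * \<rho>)\<^sup>2"
    by (simp add: power_mult_distrib)
  also have "\<dots> \<le> 16 / (4 ^ j * d)\<^sup>2"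
    using \<rho> d by (intro divide_left_mono power_mono) auto
  finally have "kern z w \<le> ennreal (16 / (4 ^ j * d)\<^sup>2)"
    using z w by (simp add: kern_def ennreal_leI)
  with j \<rho> show ?thesis
    by (intro that[of j]) (auto simp: d_def)
qed

text \<open>Countable subadditivity over an arbitrary countable index set, which fits the Vitali
  subfamily without enumerating it. The pointwise bound on indicators is integrated.\<close>

lemma emeasure_UN_countable_le:
  assumes "countable I" "\<And>i. i \<in> I \<Longrightarrow> A i \<in> sets M"
  shows "emeasure M (\<Union>i\<in>I. A i) \<le> (\<integral>\<^sup>+i. emeasure M (A i) \<partial>count_space I)"
proof -
  have [measurable]: "i \<in> I \<Longrightarrow> A i \<in> sets M" for i using assms by simp
  have "emeasure M (\<Union>i\<in>I. A i) = (\<integral>\<^sup>+x. indicator (\<Union>i\<in>I. A i) x \<partial>M)"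
    using assms by (intro nn_integral_indicator[symmetric] sets.countable_UN') auto
  also have "\<dots> \<le> (\<integral>\<^sup>+x. \<integral>\<^sup>+i. indicator (A i) x \<partial>count_space I \<partial>M)"
  proof (intro nn_integral_mono)
    fix x
    show "indicator (\<Union>i\<in>I. A i) x \<le> (\<integral>\<^sup>+i. indicator (A i) x \<partial>count_space I)"
    proof (cases "x \<in> (\<Union>i\<in>I. A i)")
      case True
      then obtain i where i: "i \<in> I" "x \<in> A i" by auto
      have "(\<integral>\<^sup>+k. indicator {i} k \<partial>count_space I) \<le> (\<integral>\<^sup>+i. indicator (A i) x \<partial>count_space I)"
        using i by (intro nn_integral_mono) (auto split: split_indicator)
      with True i show ?thesis by simp
    qed simp
  qed
  also have "\<dots> = (\<integral>\<^sup>+i. \<integral>\<^sup>+x. indicator (A i) x \<partial>M \<partial>count_space I)"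
    using assms by (intro nn_integral_count_space_nn_integral) auto
  also have "\<dots> = (\<integral>\<^sup>+i. emeasure M (A i) \<partial>count_space I)"
    using assms by (intro nn_integral_cong) auto
  finally show ?thesis .
qed

text \<open>Heavy points at the hyperbolic scale \<open>4\<^sup>j\<close>: a Vitali subfamily covers them by balls of which
  only the part within a \<open>4\<^sup>-\<^sup>j\<close> fraction of the radius from the circle matters; this beats the
  weight \<open>2\<^sup>-\<^sup>j\<close> in the density condition.\<close>
lemma weak_type_scale:
  fixes f :: "complex \<Rightarrow> ennreal" and t :: real
  assumes [measurable]: "f \<in> borel_measurable borel" and t: "t > 0"
  obtains U where "U \<in> sets borel"
    "{z. norm z < 1 \<and> ennreal (t / 2 ^ j * (4 ^ j * bdist z)\<^sup>2)
        < (\<integral>\<^sup>+w. f w * indicator (cball z (4 ^ j * bdist z)) w \<partial>lborel)} \<subseteq> U"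
    "emeasure lborel U \<le> ennreal (1600 / t / 2 ^ j) * (\<integral>\<^sup>+w. f w \<partial>lborel)"
proof -
  define r where "r z = 4 ^ j * bdist z" for z
  define \<mu> where "\<mu> = density lborel f"
  have \<mu>: "emeasure \<mu> X = (\<integral>\<^sup>+w. f w * indicator X w \<partial>lborel)" if "X \<in> sets borel" for X
    using that by (simp add: \<mu>_def emeasure_density)
  define K where "K = {z. norm z < 1 \<and> ennreal (t / 2 ^ j * (r z)\<^sup>2) < emeasure \<mu> (cball z (r z))}"
  \<comment> \<open>Vitali's lemma asks for uniformly bounded radii; \<open>bdist\<close> never
    exceeds 1/2.\<close>
  have r: "0 < r z \<and> r z \<le> 4 ^ j" if "z \<in> K" for z
    using that bdist_pos[of z] bdist_le[of z] by (simp add: K_def r_def)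
  obtain C where C: "countable C" "C \<subseteq> K"
      and disj: "pairwise (\<lambda>i j. disjnt (cball i (r i)) (cball j (r j))) C"
      and cov: "\<And>i. i \<in> K \<Longrightarrow> \<exists>c. c \<in> C \<and> \<not> disjnt (cball i (r i)) (cball c (r c)) \<and>
                        cball i (r i) \<subseteq> ball c (5 * r c)"
    by (rule Vitali_covering_lemma_cballs_balls[of K r "4 ^ j" "\<lambda>i. i"]) (use r in auto)
  define U where "U = (\<Union>c\<in>C. near_circle c (5 * r c) (5 * r c / 4 ^ j))"
  have U: "U \<in> sets borel"
    unfolding U_def using C by (intro sets.countable_UN') auto
  have "K \<subseteq> U"
  proof
    fix z assume z: "z \<in> K"
    from cov[OF z] obtain c where c: "c \<in> C" and sub: "cball z (r z) \<subseteq> ball c (5 * r c)"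
      by auto
    \<comment> \<open>The inclusion of balls also compares the radii. Dividing
      \<open>r z < 5 * r c\<close> by \<open>4 ^ j\<close> bounds \<open>bdist z\<close>, which
      places \<open>z\<close> in the thin part of the enlarged ball.\<close>
    have "dist z c + r z < 5 * r c" 
      using sub r[OF z] unfolding cball_subset_ball_iff by auto
    then have dist: "dist c z < 5 * r c" and "r z < 5 * r c"
      using zero_le_dist[of c z] r[OF z] unfolding dist_commute[of z c] by linarith+
    then have "bdist z \<le> 5 * r c / 4 ^ j"
      by (simp add: r_def)
    with dist have "z \<in> near_circle c (5 * r c) (5 * r c / 4 ^ j)"
      using z by (simp add: near_circle_def K_def)
    with c show "z \<in> U" by (auto simp: U_def)
  qed
  have "emeasure lborel U \<le> (\<integral>\<^sup>+c. emeasure lborel (near_circle c (5 * r c) (5 * r c / 4 ^ j)) \<partial>count_space C)"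
    unfolding U_def using C by (intro emeasure_UN_countable_le) auto
  also have "\<dots> \<le> (\<integral>\<^sup>+c. ennreal (1600 / t / 2 ^ j) * emeasure \<mu> (cball c (r c)) \<partial>count_space C)"
  proof (intro nn_integral_mono)
    fix c assume "c \<in> space (count_space C)"
    with C have c: "c \<in> K" by auto
    have "emeasure lborel (near_circle c (5 * r c) (5 * r c / 4 ^ j))
        \<le> ennreal (64 * (5 * r c) * (5 * r c / 4 ^ j))"
    proof (rule emeasure_near_circle_le)
      have "1 \<le> (4::real) ^ j" by simp
      then show "5 * r c / 4 ^ j \<le> 5 * r c"
        using r[OF c] by (simp add: field_simps)
    qed (use r[OF c] in simp)
    \<comment> \<open>Of the gain \<open>4 ^ j = 2 ^ j * 2 ^ j\<close>, one factor is absorbed in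
      the density threshold; the other remains and makes the sum over \<open>j\<close>
      converge.\<close>
    also have "64 * (5 * r c) * (5 * r c / 4 ^ j) = 1600 / t / 2 ^ j * (t / 2 ^ j * (r c)\<^sup>2)"
    proof -
      have "(4::real) ^ j = 2 ^ j * 2 ^ j"
        by (simp flip: power_mult_distrib)
      then show ?thesis
        using t by (simp add: field_simps power2_eq_square)
    qed
    also have "ennreal \<dots> = ennreal (1600 / t / 2 ^ j) * ennreal (t / 2 ^ j * (r c)\<^sup>2)"
      using t by (intro ennreal_mult) auto
    also have "\<dots> \<le> ennreal (1600 / t / 2 ^ j) * emeasure \<mu> (cball c (r c))"
      using c by (intro mult_left_mono) (auto simp: K_def)
    finally show "emeasure lborel (near_circle c (5 * r c) (5 * r c / 4 ^ j))
        \<le> ennreal (1600 / t / 2 ^ j) * emeasure \<mu> (cball c (r c))" .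
  qed
  also have "\<dots> = ennreal (1600 / t / 2 ^ j) * (\<integral>\<^sup>+c. emeasure \<mu> (cball c (r c)) \<partial>count_space C)"
    by (intro nn_integral_cmult) simp
  \<comment> \<open>Disjointness of the selected balls turns the sum of their masses into the mass
    of their union.\<close>
  also have "(\<integral>\<^sup>+c. emeasure \<mu> (cball c (r c)) \<partial>count_space C) = emeasure \<mu> (\<Union>c\<in>C. cball c (r c))"
    using C disj
    by (intro emeasure_UN_countable[symmetric])
       (auto simp: \<mu>_def disjoint_family_on_def pairwise_def disjnt_def)
  also have "\<dots> \<le> emeasure \<mu> UNIV"
    using C by (intro emeasure_mono) (auto simp: \<mu>_def)
  also have "\<dots> = (\<integral>\<^sup>+w. f w \<partial>lborel)"
    by (simp add: \<mu>)
  finally have "emeasure lborel U \<le> ennreal (1600 / t / 2 ^ j) * (\<integral>\<^sup>+w. f w \<partial>lborel)"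
    by (simp add: mult_left_mono)
  with \<open>K \<subseteq> U\<close> U show ?thesis
    by (intro that[of U]) (auto simp: K_def r_def \<mu>)
qed

lemma suminf_ennreal_half_powers:
  assumes "0 \<le> c"
  shows "(\<Sum>j. ennreal (c / 2 ^ j)) = ennreal (2 * c)"
proof (rule suminf_ennreal_eq)
  have "(\<lambda>j. c * (1/2) ^ j) sums (c * (1 / (1 - 1/2)))"
    by (intro sums_mult geometric_sums) simp
  then show "(\<lambda>j. c / 2 ^ j) sums (2 * c)"
    by (simp add: power_one_over mult.commute[of c 2])
qed (use assms in simp)

text \<open>At a point that is heavy at no scale, the contributions of all scales sum to at most
  \<open>s\<close>. The superlevel set is therefore covered by the sets of the single scales, whose
  areas form a convergent geometric series.\<close>

lemma weak_type_kern:
  fixes f :: "complex \<Rightarrow> ennreal" and s :: real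
  assumes [measurable]: "f \<in> borel_measurable borel" and s: "s > 0"
  shows "emeasure lborel {z. ennreal s < (\<integral>\<^sup>+w. kern z w * f w \<partial>lborel)}
      \<le> ennreal (102400 / s) * (\<integral>\<^sup>+w. f w \<partial>lborel)"
proof -
  \<comment> \<open>Light scales contribute \<open>16 * t / 2 ^ j\<close> each, in total
    \<open>32 * t = s\<close>. The areas of the covers then sum to
    \<open>3200 / t = 102400 / s\<close> times the mass of \<open>f\<close>.\<close>
  define t where "t = s / 32"
  have t: "t > 0" using s by (simp add: t_def)
  define m where "m z j = (\<integral>\<^sup>+w. f w * indicator (cball z (4 ^ j * bdist z)) w \<partial>lborel)" for z j
  define E where "E j = {z. norm z < 1 \<and> ennreal (t / 2 ^ j * (4 ^ j * bdist z)\<^sup>2) < m z j}" for j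
  have "\<forall>j. \<exists>U. U \<in> sets borel \<and> E j \<subseteq> U \<and>
      emeasure lborel U \<le> ennreal (1600 / t / 2 ^ j) * (\<integral>\<^sup>+w. f w \<partial>lborel)"
    unfolding E_def m_def by (intro allI, rule weak_type_scale[OF assms(1) t]) blast
  then obtain U where U [measurable]: "\<And>j. U j \<in> sets borel" and EU: "\<And>j. E j \<subseteq> U j"
      and Ule: "\<And>j. emeasure lborel (U j) \<le> ennreal (1600 / t / 2 ^ j) * (\<integral>\<^sup>+w. f w \<partial>lborel)"
    by metis
  have "{z. ennreal s < (\<integral>\<^sup>+w. kern z w * f w \<partial>lborel)} \<subseteq> (\<Union>j. U j)"
  proof (rule ccontr)
    assume "\<not> ?thesis"
    then obtain z where z: "ennreal s < (\<integral>\<^sup>+w. kern z w * f w \<partial>lborel)" and zE: "\<And>j. z \<notin> E j"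
      using EU by blast
    have z1: "norm z < 1"
      using z by (rule contrapos_pp) (simp add: kern_def)
    have d: "bdist z > 0" using z1 by (rule bdist_pos)
    have le: "m z j \<le> ennreal (t / 2 ^ j * (4 ^ j * bdist z)\<^sup>2)" for j
      using zE[of j] z1 by (simp add: E_def not_less)
    let ?a = "\<lambda>j w. ennreal (16 / (4 ^ j * bdist z)\<^sup>2) * (f w * indicator (cball z (4 ^ j * bdist z)) w)"
    \<comment> \<open>The scale that controls the kernel depends on \<open>w\<close>; the sum over
      all scales dominates whichever one occurs.\<close>
    have "(\<integral>\<^sup>+w. kern z w * f w \<partial>lborel) \<le> (\<integral>\<^sup>+w. (\<Sum>j. ?a j w) \<partial>lborel)"
    proof (intro nn_integral_mono)
      fix w
      show "kern z w * f w \<le> (\<Sum>j. ?a j w)"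
      proof (cases "norm w < 1")
        case True
        obtain j where j: "w \<in> cball z (4 ^ j * bdist z)"
            "kern z w \<le> ennreal (16 / (4 ^ j * bdist z)\<^sup>2)"
          using kern_le_scale[OF z1 True] by blast
        then have "kern z w * f w \<le> ?a j w"
          by (auto intro!: mult_right_mono)
        also have "\<dots> \<le> (\<Sum>j. ?a j w)"
          using sum_le_suminf[of "\<lambda>j. ?a j w" "{j}"] by simp
        finally show ?thesis .
      qed (simp add: kern_def)
    qed
    also have "\<dots> = (\<Sum>j. ennreal (16 / (4 ^ j * bdist z)\<^sup>2) * m z j)"
    proof -
      have [measurable]: "(\<lambda>w. f w * indicator (cball z (4 ^ j * bdist z)) w) \<in> borel_measurable lborel" for j
        using assms(1) by (intro borel_measurable_times_ennreal borel_measurable_indicator) simp_all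
      show ?thesis
        unfolding m_def
        by (subst nn_integral_suminf) (simp_all add: nn_integral_cmult)
    qed
    also have "\<dots> \<le> (\<Sum>j. ennreal (16 * t / 2 ^ j))"
    proof (intro suminf_le)
      fix j
      have "ennreal (16 / (4 ^ j * bdist z)\<^sup>2) * m z j
          \<le> ennreal (16 / (4 ^ j * bdist z)\<^sup>2) * ennreal (t / 2 ^ j * (4 ^ j * bdist z)\<^sup>2)"
        using le by (intro mult_left_mono) auto
      also have "\<dots> = ennreal (16 / (4 ^ j * bdist z)\<^sup>2 * (t / 2 ^ j * (4 ^ j * bdist z)\<^sup>2))"
        using t by (intro ennreal_mult[symmetric]) auto
      also have "16 / (4 ^ j * bdist z)\<^sup>2 * (t / 2 ^ j * (4 ^ j * bdist z)\<^sup>2) = 16 * t / 2 ^ j"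
        using d by simp
      finally show "ennreal (16 / (4 ^ j * bdist z)\<^sup>2) * m z j \<le> ennreal (16 * t / 2 ^ j)" .
    qed auto
    also have "\<dots> = ennreal s"
      using t by (subst suminf_ennreal_half_powers) (auto simp: t_def)
    finally show False using z by simp
  qed
  then have "emeasure lborel {z. ennreal s < (\<integral>\<^sup>+w. kern z w * f w \<partial>lborel)} \<le> emeasure lborel (\<Union>j. U j)"
    by (intro emeasure_mono) auto
  also have "\<dots> \<le> (\<Sum>j. emeasure lborel (U j))"
    by (intro emeasure_subadditive_countably) auto
  also have "\<dots> \<le> (\<Sum>j. ennreal (1600 / t / 2 ^ j) * (\<integral>\<^sup>+w. f w \<partial>lborel))"
    by (intro suminf_le Ule) auto
  also have "\<dots> = ennreal (102400 / s) * (\<integral>\<^sup>+w. f w \<partial>lborel)"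
    using t by (subst ennreal_suminf_multc, subst suminf_ennreal_half_powers) (auto simp: t_def)
  finally show ?thesis .
qed

section \<open>Exponential integrability of the kernel integrals\<close>

text \<open>For \<open>w\<close> in the disc, the number of scales \<open>4 ^ j * bdist w\<close>
  that stay below the bound 8 of \<open>kern_le_scale\<close>. It is of the order of the logarithm
  of \<open>8 / bdist w\<close>.\<close>

definition scale_count :: "complex \<Rightarrow> nat" where
  "scale_count w = (LEAST j. 8 < 4 ^ j * bdist w)"

lemma measurable_scale_count [measurable]: "scale_count \<in> measurable borel (count_space UNIV)"
  unfolding scale_count_def by measurable

lemma less_scale_count_iff:
  assumes "norm w < 1"
  shows "j < scale_count w \<longleftrightarrow> 4 ^ j * bdist w \<le> 8"
proof
  assume "j < scale_count w"
  then show "4 ^ j * bdist w \<le> 8"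
    unfolding scale_count_def by (auto dest: not_less_Least)
next
  assume j: "4 ^ j * bdist w \<le> 8"
  have d: "bdist w > 0" using assms by (rule bdist_pos)
  obtain i where "8 / bdist w < 4 ^ i"
    using real_arch_pow[of 4 "8 / bdist w"] by auto
  then have "8 < 4 ^ i * bdist w"
    using d by (simp add: field_simps)
  then have N: "8 < 4 ^ scale_count w * bdist w"
    unfolding scale_count_def by (rule LeastI)
  show "j < scale_count w"
  proof (rule ccontr)
    assume "\<not> j < scale_count w"
    then have "4 ^ scale_count w * bdist w \<le> 4 ^ j * bdist w"
      using d by (intro mult_right_mono power_increasing) auto
    with N j show False by linarith
  qed
qed

lemma emeasure_cball_complex_le:
  fixes a :: complex
  assumes "R \<ge> 0"
  shows "emeasure lborel (cball a R) \<le> ennreal (4 * R\<^sup>2)"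
proof -
  have "emeasure lborel (cball a R) \<le> emeasure lborel (cbox (a - Complex R R) (a + Complex R R))"
  proof (intro emeasure_mono)
    have "\<bar>Re x - Re a\<bar> \<le> R \<and> \<bar>Im x - Im a\<bar> \<le> R" if "dist a x \<le> R" for x
      using abs_Re_le_cmod[of "x - a"] abs_Im_le_cmod[of "x - a"] that
      by (auto simp: dist_norm norm_minus_commute)
    then show "cball a R \<subseteq> cbox (a - Complex R R) (a + Complex R R)"
      by (fastforce simp: cbox_def Basis_complex_def abs_le_iff)
  qed simp
  also have "\<dots> = ennreal (4 * R\<^sup>2)"
    using assms by (subst emeasure_lborel_cbox) (auto simp: Basis_complex_def power2_eq_square)
  finally show ?thesis .
qed

text \<open>By symmetry of the kernel the scales can be centred at \<open>w\<close>. A scale of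
  radius \<open>R\<close> contributes at most \<open>16 / R^2\<close> times the area bound
  \<open>4 * R^2\<close>, that is 64, and only \<open>scale_count w\<close> scales occur.\<close>

lemma nn_integral_kern_le:
  assumes "norm w < 1"
  shows "(\<integral>\<^sup>+z. kern z w \<partial>lborel) \<le> ennreal (64 * real (scale_count w))"
proof -
  define R where "R j = 4 ^ j * bdist w" for j
  have R: "R j > 0" for j using bdist_pos[OF assms] by (simp add: R_def)
  let ?a = "\<lambda>j z. ennreal (16 / (R j)\<^sup>2) * indicator (cball w (R j)) z"
  have "(\<integral>\<^sup>+z. kern z w \<partial>lborel) \<le> (\<integral>\<^sup>+z. (\<Sum>j<scale_count w. ?a j z) \<partial>lborel)"
  proof (intro nn_integral_mono)
    fix z
    show "kern z w \<le> (\<Sum>j<scale_count w. ?a j z)"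
    proof (cases "norm z < 1")
      case True
      obtain j where j: "4 ^ j * bdist w \<le> 8" "z \<in> cball w (R j)"
          "kern w z \<le> ennreal (16 / (R j)\<^sup>2)"
        using kern_le_scale[OF assms True] unfolding R_def by blast
      then have "kern z w \<le> ?a j z"
        by (simp add: kern_commute)
      also have "\<dots> \<le> (\<Sum>j<scale_count w. ?a j z)"
        using j(1) less_scale_count_iff[OF assms] by (intro member_le_sum) auto
      finally show ?thesis .
    qed (simp add: kern_def)
  qed
  also have "\<dots> = (\<Sum>j<scale_count w. ennreal (16 / (R j)\<^sup>2) * emeasure lborel (cball w (R j)))"
    by (subst nn_integral_sum)
       (auto simp: nn_integral_cmult_indicator
          intro!: borel_measurable_times_ennreal borel_measurable_indicator)
  also have "\<dots> \<le> (\<Sum>j<scale_count w. ennreal 64)"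
  proof (intro sum_mono)
    fix j
    have "ennreal (16 / (R j)\<^sup>2) * emeasure lborel (cball w (R j))
        \<le> ennreal (16 / (R j)\<^sup>2) * ennreal (4 * (R j)\<^sup>2)"
      using R[of j] by (intro mult_left_mono emeasure_cball_complex_le) auto
    also have "\<dots> = ennreal 64"
      using R[of j] by (simp flip: ennreal_mult)
    finally show "ennreal (16 / (R j)\<^sup>2) * emeasure lborel (cball w (R j)) \<le> ennreal 64" .
  qed
  also have "\<dots> = ennreal (64 * real (scale_count w))"
    by (simp add: ennreal_of_nat_eq_real_of_nat ennreal_mult' mult.commute flip: ennreal_numeral)
  finally show ?thesis .
qed

text \<open>Write \<open>2 ^ N\<close> as 1 plus the sum of \<open>2 ^ j\<close> over
  \<open>j < N\<close>. The region where \<open>j\<close> is counted has area at most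
  \<open>4096 / 4 ^ j\<close>, so the weight \<open>2 ^ j\<close> still leaves a convergent series:
  4096 for the summand 1, and 8192 for the rest.\<close>

lemma nn_integral_two_power_scale_count_le:
  "(\<integral>\<^sup>+w. ennreal (2 ^ scale_count w) * indicator (ball 0 1) w \<partial>lborel) \<le> ennreal 12288"
proof -
  \<comment> \<open>The ball of radius 8 contains the whole disc, so only the distance to the circle
    is restricted; 8 is large enough for the area bound to apply at \<open>j = 0\<close>.\<close>
  let ?S = "\<lambda>j. near_circle 0 8 (8 / 4 ^ j)"
  have S: "emeasure lborel (?S j) \<le> ennreal (4096 / 4 ^ j)" for j
  proof -
    have "1 \<le> (4::real) ^ j" by simp
    then have "8 / 4 ^ j \<le> (8::real)" by (simp add: field_simps)
    then show ?thesis
      using emeasure_near_circle_le[of "8 / 4 ^ j" 8 0] by simp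
  qed
  have "(\<integral>\<^sup>+w. ennreal (2 ^ scale_count w) * indicator (ball 0 1) w \<partial>lborel)
      \<le> (\<integral>\<^sup>+w. indicator (?S 0) w + (\<Sum>j. ennreal (2 ^ j) * indicator (?S j) w) \<partial>lborel)"
  proof (intro nn_integral_mono)
    fix w :: complex
    show "ennreal (2 ^ scale_count w) * indicator (ball 0 1) w
        \<le> indicator (?S 0) w + (\<Sum>j. ennreal (2 ^ j) * indicator (?S j) w)"
    proof (cases "norm w < 1")
      case True
      then have mem: "w \<in> ?S j" if "j < scale_count w" for j
        using that less_scale_count_iff[OF True, of j]
        by (auto simp: near_circle_def field_simps)
      have "w \<in> ?S 0"
        using True bdist_le[of w] by (auto simp: near_circle_def)
      moreover have "ennreal (2 ^ scale_count w) = 1 + (\<Sum>j<scale_count w. ennreal (2 ^ j))"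
      proof -
        have "(2::real) ^ n = 1 + (\<Sum>j<n. 2 ^ j)" for n
          by (induction n) auto
        then have "ennreal (2 ^ scale_count w) = ennreal (1 + (\<Sum>j<scale_count w. 2 ^ j))"
          by (rule arg_cong)
        then show ?thesis
          by (simp add: ennreal_plus sum_nonneg flip: sum_ennreal)
      qed
      moreover have "(\<Sum>j<scale_count w. ennreal (2 ^ j)) \<le> (\<Sum>j. ennreal (2 ^ j) * indicator (?S j) w)"
        using sum_le_suminf[of "\<lambda>j. ennreal (2 ^ j) * indicator (?S j) w" "{..<scale_count w}"]
        by (simp add: mem)
      ultimately show ?thesis
        using True by (simp add: add_left_mono)
    qed simp
  qed
  also have "\<dots> = emeasure lborel (?S 0) + (\<Sum>j. ennreal (2 ^ j) * emeasure lborel (?S j))"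
    by (subst nn_integral_add, simp, simp, subst nn_integral_suminf)
       (simp_all add: nn_integral_cmult_indicator)
  also have "\<dots> \<le> ennreal 4096 + (\<Sum>j. ennreal (4096 / 2 ^ j))"
  proof (intro add_mono suminf_le)
    show "emeasure lborel (?S 0) \<le> ennreal 4096" using S[of 0] by simp
    fix j
    have "ennreal (2 ^ j) * emeasure lborel (?S j) \<le> ennreal (2 ^ j) * ennreal (4096 / 4 ^ j)"
      by (intro mult_left_mono S) auto
    also have "\<dots> = ennreal (4096 / 2 ^ j)"
    proof -
      have "(4::real) ^ j = 2 ^ j * 2 ^ j"
        by (simp flip: power_mult_distrib)
      then show ?thesis
        by (simp flip: ennreal_mult)
    qed
    finally show "ennreal (2 ^ j) * emeasure lborel (?S j) \<le> ennreal (4096 / 2 ^ j)" .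
  qed auto
  also have "\<dots> = ennreal 12288"
    by (subst suminf_ennreal_half_powers) (simp_all flip: ennreal_plus)
  finally show ?thesis .
qed

section \<open>An elementary Young inequality\<close>

lemma power_le_fact_mult_exp:
  fixes x :: real
  assumes "x \<ge> 0"
  shows "x ^ k \<le> fact k * exp x"
proof -
  have "(\<Sum>n\<in>{k}. x ^ n /\<^sub>R fact n) \<le> (\<Sum>n. x ^ n /\<^sub>R fact n)"
    using assms by (intro sum_le_suminf summable_exp_generic) auto
  then show ?thesis
    by (simp add: exp_def field_simps)
qed

text \<open>Either \<open>M\<close> is dominated by the logarithm of \<open>t\<close>, or \<open>t\<close> by a small exponential of \<open>M\<close>.\<close>
lemma mult_power_le_Phi_LlogL:
  fixes t M :: real
  assumes t: "t \<ge> 0" and M: "M \<ge> 0"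
  shows "t * M ^ k \<le> 4 ^ k * Phi_LlogL k t + 4 ^ k * fact k * 2 powr M"
proof -
  have log: "0 \<le> log_plus t" by (simp add: log_plus_def)
  then have Phi: "0 \<le> Phi_LlogL k t" using t by (simp add: Phi_LlogL_def)
  show ?thesis
  proof (cases "M \<le> 4 * log_plus t")
    case True
    then have "t * M ^ k \<le> t * (4 * log_plus t) ^ k"
      using t M by (intro mult_left_mono power_mono) auto
    also have "\<dots> = 4 ^ k * Phi_LlogL k t"
      by (simp add: Phi_LlogL_def power_mult_distrib)
    finally show ?thesis
      by (smt (verit) fact_ge_zero mult_nonneg_nonneg powr_ge_zero zero_le_power)
  next
    case False
    \<comment> \<open>Both \<open>t\<close> and, up to \<open>4 ^ k * fact k\<close>, the power
      \<open>M ^ k\<close> cost one factor \<open>exp (M / 4)\<close>. Their product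
      \<open>exp (M / 2)\<close> stays below \<open>2 powr M\<close>, the exponential known to be
      integrable.\<close>
    have "t \<le> exp (M / 4)"
    proof (cases "t > 0")
      case True
      then have "ln t \<le> M / 4" using False by (auto simp: log_plus_def split: if_splits)
      then show ?thesis using True by (metis exp_le_cancel_iff exp_ln)
    qed (use t in auto)
    moreover have "(M / 4) ^ k \<le> fact k * exp (M / 4)"
      using M by (intro power_le_fact_mult_exp) auto
    then have "M ^ k \<le> 4 ^ k * fact k * exp (M / 4)"
      by (simp add: power_divide field_simps)
    ultimately have "t * M ^ k \<le> exp (M / 4) * (4 ^ k * fact k * exp (M / 4))"
      using t M by (intro mult_mono) auto
    also have "\<dots> = 4 ^ k * fact k * exp (M * (1/2))"
      by (simp flip: exp_add)
    also have "exp (M * (1/2)) \<le> exp (M * ln 2)"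
    proof -
      have "exp (1/2) \<le> (2::real)"
      proof (rule power2_le_imp_le)
        show "(exp (1/2))\<^sup>2 \<le> (2::real)\<^sup>2"
          using exp_le by (simp add: power2_eq_square flip: exp_add)
      qed simp
      then have "1/2 \<le> ln (2::real)" by (intro iffD2[OF ln_ge_iff]) simp_all
      then show ?thesis using M unfolding exp_le_cancel_iff by (rule mult_left_mono)
    qed
    finally have "t * M ^ k \<le> 4 ^ k * fact k * 2 powr M"
      by (simp add: powr_def mult_left_mono)
    then show ?thesis
      using Phi by (smt (verit) mult_nonneg_nonneg zero_le_power)
  qed
qed

section \<open>Several variables\<close>

lemma Basis_vec_eq: "(Basis :: ('a::euclidean_space ^ 'n) set) = (\<lambda>(i, b). axis i b) ` (UNIV \<times> Basis)"
  by (auto simp: Basis_vec_def)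

lemma prod_Basis_vec:
  "(\<Prod>b\<in>(Basis :: ('a::euclidean_space ^ 'n) set). f b) = (\<Prod>i\<in>UNIV. \<Prod>b\<in>Basis. f (axis i b))"
proof -
  have "inj_on (\<lambda>(i, b). axis i b :: 'a ^ 'n) (UNIV \<times> Basis)"
    by (auto simp: inj_on_def axis_eq_axis)
  then show ?thesis
    unfolding Basis_vec_eq
    by (subst prod.reindex) (simp_all add: prod.cartesian_product case_prod_beta comp_def)
qed

lemma measurable_vec_lambda:
  fixes g :: "'b \<Rightarrow> 'n::finite \<Rightarrow> 'a::euclidean_space"
  assumes [measurable]: "\<And>i. (\<lambda>x. g x i) \<in> borel_measurable M"
  shows "(\<lambda>x. vec_lambda (g x)) \<in> borel_measurable M"
proof (subst borel_measurable_euclidean_space, rule ballI)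
  fix b :: "'a ^ 'n" assume "b \<in> Basis"
  then obtain i c where b: "b = axis i c" by (auto simp: Basis_vec_def)
  show "(\<lambda>x. vec_lambda (g x) \<bullet> b) \<in> borel_measurable M"
    unfolding b inner_axis by simp
qed

lemma measurable_vec_nth' [measurable (raw)]:
  fixes f :: "'b \<Rightarrow> 'a::euclidean_space ^ 'n"
  assumes "f \<in> borel_measurable M"
  shows "(\<lambda>x. f x $ i) \<in> borel_measurable M"
  by (rule measurable_compose[OF assms])
     (intro borel_measurable_continuous_onI continuous_intros)

text \<open>Basis vectors correspond to pairs of a coordinate and a basis element of the factor, so
  the volume of a box regroups into a product over coordinates. This gives access to Tonelli for
  finite products.\<close>

lemma lborel_vec_eq:
  "(lborel :: ('a::euclidean_space ^ 'n::finite) measure) = distr (\<Pi>\<^sub>M i\<in>UNIV. lborel) borel vec_lambda"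
proof (rule lborel_eqI)
  interpret product_sigma_finite "\<lambda>_::'n. lborel :: 'a measure" ..
  have m: "vec_lambda \<in> borel_measurable (\<Pi>\<^sub>M i\<in>UNIV. lborel)"
    by (rule measurable_vec_lambda) simp
  fix l u :: "'a ^ 'n"
  assume le: "\<And>b. b \<in> Basis \<Longrightarrow> l \<bullet> b \<le> u \<bullet> b"
  have le': "l $ i \<bullet> b \<le> u $ i \<bullet> b" if "b \<in> Basis" for i b
    using le[of "axis i b"] that by (auto simp: inner_axis Basis_vec_def)
  have "vec_lambda -` box l u \<inter> space (\<Pi>\<^sub>M i\<in>UNIV. lborel) = (\<Pi>\<^sub>E i\<in>UNIV. box (l $ i) (u $ i))"
    by (fastforce simp: box_def Basis_vec_eq inner_axis space_PiM PiE_def)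
  then have "emeasure (distr (\<Pi>\<^sub>M i\<in>UNIV. lborel) borel vec_lambda) (box l u)
      = emeasure (\<Pi>\<^sub>M i\<in>UNIV. lborel) (\<Pi>\<^sub>E i\<in>UNIV. box (l $ i) (u $ i))"
    by (simp add: emeasure_distr m)
  also have "\<dots> = (\<Prod>i\<in>UNIV. emeasure lborel (box (l $ i) (u $ i)))"
    by (intro emeasure_PiM) auto
  also have "\<dots> = ennreal (\<Prod>b\<in>Basis. (u - l) \<bullet> b)"
    using le' by (simp add: prod_Basis_vec inner_axis prod_ennreal prod_nonneg inner_diff_left)
  finally show "emeasure (distr (\<Pi>\<^sub>M i\<in>UNIV. lborel) borel vec_lambda) (box l u)
      = ennreal (\<Prod>b\<in>Basis. (u - l) \<bullet> b)" .
qed simp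

lemma nn_integral_lborel_vec_prod:
  fixes f :: "'a::euclidean_space \<Rightarrow> ennreal"
  assumes [measurable]: "f \<in> borel_measurable borel"
  shows "(\<integral>\<^sup>+w. (\<Prod>i\<in>(UNIV :: 'n::finite set). f (w $ i)) \<partial>lborel)
      = (\<integral>\<^sup>+x. f x \<partial>lborel) ^ CARD('n)"
proof -
  interpret product_sigma_finite "\<lambda>_::'n. lborel :: 'a measure" ..
  have m: "vec_lambda \<in> borel_measurable (\<Pi>\<^sub>M i\<in>(UNIV :: 'n set). (lborel :: 'a measure))"
    by (rule measurable_vec_lambda) simp
  show ?thesis
    by (subst lborel_vec_eq, subst nn_integral_distr[OF m])
       (simp_all add: product_nn_integral_prod[of UNIV "\<lambda>_. f"])
qed

definition vec_split :: "'n::finite \<Rightarrow> ('n \<Rightarrow> 'a) \<Rightarrow> 'a \<Rightarrow> 'a ^ 'n" where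
  "vec_split j y x = (\<chi> i. if i = j then x else y i)"

lemma measurable_vec_split [measurable]:
  "(\<lambda>(y, x). vec_split j y x) \<in> borel_measurable
    ((\<Pi>\<^sub>M i\<in>UNIV - {j}. (lborel :: 'a::euclidean_space measure)) \<Otimes>\<^sub>M lborel)"
proof -
  have "(\<lambda>p. vec_split j (fst p) (snd p)) \<in> borel_measurable
    ((\<Pi>\<^sub>M i\<in>UNIV - {j}. (lborel :: 'a measure)) \<Otimes>\<^sub>M lborel)"
    unfolding vec_split_def
  proof (rule measurable_vec_lambda)
    fix i
    show "(\<lambda>p. if i = j then snd p else fst p i) \<in> borel_measurable
      ((\<Pi>\<^sub>M i\<in>UNIV - {j}. (lborel :: 'a measure)) \<Otimes>\<^sub>M lborel)"
    proof (cases "i = j")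
      case False
      then have "(\<lambda>y. y i) \<in> measurable (\<Pi>\<^sub>M i\<in>UNIV - {j}. (lborel :: 'a measure)) lborel"
        by (intro measurable_component_singleton) auto
      from measurable_compose[OF measurable_fst this] False show ?thesis by simp
    qed simp
  qed
  then show ?thesis by (simp add: case_prod_beta)
qed

text \<open>Tonelli with coordinate \<open>j\<close> isolated. The first order measures a set fibre
  by fibre; the second puts the one-variable kernel in the outer integral.\<close>

lemma nn_integral_vec_split:
  fixes F :: "'a::euclidean_space ^ 'n \<Rightarrow> ennreal"
  assumes [measurable]: "F \<in> borel_measurable borel"
  shows "(\<integral>\<^sup>+w. F w \<partial>lborel) = (\<integral>\<^sup>+y. \<integral>\<^sup>+x. F (vec_split j y x) \<partial>lborel \<partial>(\<Pi>\<^sub>M i\<in>UNIV - {j}. lborel))"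
    and "(\<integral>\<^sup>+w. F w \<partial>lborel) = (\<integral>\<^sup>+x. \<integral>\<^sup>+y. F (vec_split j y x) \<partial>(\<Pi>\<^sub>M i\<in>UNIV - {j}. lborel) \<partial>lborel)"
proof -
  interpret product_sigma_finite "\<lambda>_::'n. lborel :: 'a measure" ..
  have m: "vec_lambda \<in> borel_measurable (\<Pi>\<^sub>M i\<in>(UNIV :: 'n set). (lborel :: 'a measure))"
    by (rule measurable_vec_lambda) simp
  have U: "insert j (UNIV - {j}) = UNIV" by auto
  have m': "(\<lambda>y. F (vec_lambda y)) \<in> borel_measurable (\<Pi>\<^sub>M i\<in>insert j (UNIV - {j}). (lborel :: 'a measure))"
    unfolding U using m by measurable
  have eq: "(\<integral>\<^sup>+w. F w \<partial>lborel)
      = (\<integral>\<^sup>+y. F (vec_lambda y) \<partial>(\<Pi>\<^sub>M i\<in>insert j (UNIV - {j}). (lborel :: 'a measure)))"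
    unfolding U by (subst lborel_vec_eq, subst nn_integral_distr[OF m]) simp_all
  have split: "vec_lambda (y(j := x)) = vec_split j y x" for x :: 'a and y
    by (auto simp: vec_split_def vec_eq_iff)
  show "(\<integral>\<^sup>+w. F w \<partial>lborel) = (\<integral>\<^sup>+y. \<integral>\<^sup>+x. F (vec_split j y x) \<partial>lborel \<partial>(\<Pi>\<^sub>M i\<in>UNIV - {j}. lborel))"
    using product_nn_integral_insert[OF _ _ m'] by (simp add: eq split)
  show "(\<integral>\<^sup>+w. F w \<partial>lborel) = (\<integral>\<^sup>+x. \<integral>\<^sup>+y. F (vec_split j y x) \<partial>(\<Pi>\<^sub>M i\<in>UNIV - {j}. lborel) \<partial>lborel)"
    using product_nn_integral_insert_rev[OF _ _ m'] by (simp add: eq split)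
qed

section \<open>Weak type in one coordinate, integration in the others\<close>

text \<open>For frozen \<open>y\<close> the inner integral \<open>h y\<close> is a function of one
  complex variable, to which \<open>weak_type_kern\<close> applies. Integrating over
  \<open>y\<close> and exchanging integrals moves the \<open>y\<close>-integration onto
  \<open>K\<close> alone. \<open>Q\<close> stands for the measure of the remaining
  coordinates.\<close>

lemma weak_type_kern_fibred:
  fixes K :: "'b \<Rightarrow> 'b \<Rightarrow> ennreal" and G :: "'b \<Rightarrow> complex \<Rightarrow> ennreal"
  assumes "sigma_finite_measure Q"
    and [measurable]: "case_prod K \<in> borel_measurable (Q \<Otimes>\<^sub>M Q)"
      "case_prod G \<in> borel_measurable (Q \<Otimes>\<^sub>M lborel)"
    and s: "s > 0"
  shows "(\<integral>\<^sup>+y. emeasure lborel {x. ennreal s < (\<integral>\<^sup>+x'. kern x x' * (\<integral>\<^sup>+y'. K y y' * G y' x' \<partial>Q) \<partial>lborel)} \<partial>Q)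
    \<le> ennreal (102400 / s) * (\<integral>\<^sup>+x'. \<integral>\<^sup>+y'. (\<integral>\<^sup>+y. K y y' \<partial>Q) * G y' x' \<partial>Q \<partial>lborel)"
proof -
  interpret sigma_finite_measure Q by fact
  interpret QQ: pair_sigma_finite Q Q ..
  interpret QL: pair_sigma_finite Q "lborel :: complex measure" ..
  define h where "h y x' = (\<integral>\<^sup>+y'. K y y' * G y' x' \<partial>Q)" for y x'
  have h [measurable]: "case_prod h \<in> borel_measurable (Q \<Otimes>\<^sub>M lborel)"
    unfolding h_def by measurable
  have "(\<integral>\<^sup>+y. \<integral>\<^sup>+x'. h y x' \<partial>lborel \<partial>Q) = (\<integral>\<^sup>+x'. \<integral>\<^sup>+y. h y x' \<partial>Q \<partial>lborel)"
    by (intro QL.Fubini'[symmetric]) measurable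
  also have "\<dots> = (\<integral>\<^sup>+x'. \<integral>\<^sup>+y'. (\<integral>\<^sup>+y. K y y' \<partial>Q) * G y' x' \<partial>Q \<partial>lborel)"
  proof (rule nn_integral_cong)
    fix x' :: complex
    have "(\<integral>\<^sup>+y. h y x' \<partial>Q) = (\<integral>\<^sup>+y'. \<integral>\<^sup>+y. K y y' * G y' x' \<partial>Q \<partial>Q)"
      unfolding h_def by (intro QQ.Fubini'[symmetric]) measurable
    also have "\<dots> = (\<integral>\<^sup>+y'. (\<integral>\<^sup>+y. K y y' \<partial>Q) * G y' x' \<partial>Q)"
      by (intro nn_integral_cong nn_integral_multc) measurable
    finally show "(\<integral>\<^sup>+y. h y x' \<partial>Q) = (\<integral>\<^sup>+y'. (\<integral>\<^sup>+y. K y y' \<partial>Q) * G y' x' \<partial>Q)" .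
  qed
  finally have I: "(\<integral>\<^sup>+y. \<integral>\<^sup>+x'. h y x' \<partial>lborel \<partial>Q)
      = (\<integral>\<^sup>+x'. \<integral>\<^sup>+y'. (\<integral>\<^sup>+y. K y y' \<partial>Q) * G y' x' \<partial>Q \<partial>lborel)" .
  have "(\<integral>\<^sup>+y. emeasure lborel {x. ennreal s < (\<integral>\<^sup>+x'. kern x x' * h y x' \<partial>lborel)} \<partial>Q)
      \<le> (\<integral>\<^sup>+y. ennreal (102400 / s) * (\<integral>\<^sup>+x'. h y x' \<partial>lborel) \<partial>Q)"
  proof (intro nn_integral_mono)
    fix y assume [measurable]: "y \<in> space Q"
    have "h y \<in> borel_measurable lborel" by measurable
    then show "emeasure lborel {x. ennreal s < (\<integral>\<^sup>+x'. kern x x' * h y x' \<partial>lborel)}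
        \<le> ennreal (102400 / s) * (\<integral>\<^sup>+x'. h y x' \<partial>lborel)"
      using s by (intro weak_type_kern) auto
  qed
  also have "\<dots> = ennreal (102400 / s) * (\<integral>\<^sup>+y. \<integral>\<^sup>+x'. h y x' \<partial>lborel \<partial>Q)"
    by (intro nn_integral_cmult) measurable
  finally show ?thesis
    unfolding I by (simp only: h_def)
qed

text \<open>The product kernel separates into \<open>kern\<close> in coordinate \<open>j\<close> and
  a kernel \<open>K\<close> in the others, which is the fibred situation. No weak type estimate is
  iterated: the other coordinates only contribute integrals of the kernel.\<close>

lemma weak_type_kern_vec:
  fixes G :: "complex ^ 'n \<Rightarrow> ennreal" and j :: 'n
  assumes [measurable]: "G \<in> borel_measurable borel" and s: "s > 0"
  shows "emeasure lborel {z. ennreal s < (\<integral>\<^sup>+w. (\<Prod>i\<in>UNIV. kern (z $ i) (w $ i)) * G w \<partial>lborel)}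
    \<le> ennreal (102400 / s) *
      (\<integral>\<^sup>+w. (\<Prod>i\<in>UNIV - {j}. \<integral>\<^sup>+z. kern z (w $ i) \<partial>lborel) * G w \<partial>lborel)"
proof -
  define J where "J = UNIV - {j}"
  define Q where "Q = (\<Pi>\<^sub>M i\<in>J. (lborel :: complex measure))"
  interpret product_sigma_finite "\<lambda>_::'n. lborel :: complex measure" ..
  interpret J: finite_product_sigma_finite "\<lambda>_::'n. lborel :: complex measure" J
    by standard (simp add: J_def)
  have Q: "sigma_finite_measure Q"
    unfolding Q_def by (rule J.sigma_finite_measure_axioms)
  define K where "K y y' = (\<Prod>i\<in>J. kern (y i) (y' i))" for y y'
  have comp [measurable]: "(\<lambda>y. y i) \<in> borel_measurable Q" if "i \<in> J" for i
    using measurable_component_singleton[OF that, of "\<lambda>_. lborel :: complex measure"]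
    by (simp add: Q_def)
  have K [measurable]: "case_prod K \<in> borel_measurable (Q \<Otimes>\<^sub>M Q)"
    unfolding K_def case_prod_beta
    by (intro borel_measurable_prod_ennreal measurable_kern
        measurable_compose[OF measurable_fst comp] measurable_compose[OF measurable_snd comp])
  have v [measurable]: "(\<lambda>(y, x). vec_split j y x) \<in> borel_measurable (Q \<Otimes>\<^sub>M lborel)"
    unfolding Q_def J_def by measurable
  have Gv: "(\<lambda>(y, x). G (vec_split j y x)) \<in> borel_measurable (Q \<Otimes>\<^sub>M lborel)"
    using measurable_compose[OF v assms(1)] by (simp add: case_prod_beta)
  define H where "H z = (\<integral>\<^sup>+w. (\<Prod>i\<in>UNIV. kern (z $ i) (w $ i)) * G w \<partial>lborel)" for z
  have [measurable]: "H \<in> borel_measurable borel"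
    unfolding H_def by measurable
  have split_prod: "(\<Prod>i\<in>UNIV. f i (vec_split j y x $ i)) = f j x * (\<Prod>i\<in>J. f i (y i))"
    for f :: "'n \<Rightarrow> complex \<Rightarrow> ennreal" and x y
    unfolding J_def by (subst prod.remove[of UNIV j]) (auto simp: vec_split_def intro!: prod.cong)
  have H_split: "H (vec_split j y x) = (\<integral>\<^sup>+x'. kern x x' * (\<integral>\<^sup>+y'. K y y' * G (vec_split j y' x') \<partial>Q) \<partial>lborel)"
    if y [measurable]: "y \<in> space Q" for y x
  proof -
    have prod: "(\<Prod>i\<in>UNIV. kern (vec_split j y x $ i) (vec_split j y' x' $ i)) = kern x x' * K y y'" for y' x'
      using split_prod[of "\<lambda>i. kern (vec_split j y x $ i)" y' x']
      by (auto simp: K_def J_def vec_split_def intro!: prod.cong)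
    have [measurable]: "K y \<in> borel_measurable Q" by measurable
    have [measurable]: "(\<lambda>y'. G (vec_split j y' x')) \<in> borel_measurable Q" for x'
      using measurable_compose[OF _ Gv, of "\<lambda>y'. (y', x')" Q] by simp
    have "H (vec_split j y x) = (\<integral>\<^sup>+x'. \<integral>\<^sup>+y'. kern x x' * (K y y' * G (vec_split j y' x')) \<partial>Q \<partial>lborel)"
      unfolding H_def
      by (subst nn_integral_vec_split(2)[where j = j]) (simp_all add: prod Q_def J_def mult.assoc)
    also have "\<dots> = (\<integral>\<^sup>+x'. kern x x' * (\<integral>\<^sup>+y'. K y y' * G (vec_split j y' x') \<partial>Q) \<partial>lborel)"
      by (intro nn_integral_cong nn_integral_cmult) measurable
    finally show ?thesis .
  qed
  \<comment> \<open>The source of the logarithms: integrating \<open>K\<close> in its first argument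
    gives one kernel integral for each coordinate other than \<open>j\<close>.\<close>
  have K_int: "(\<integral>\<^sup>+y. K y y' \<partial>Q) = (\<Prod>i\<in>J. \<integral>\<^sup>+z. kern z (y' i) \<partial>lborel)" for y'
    unfolding K_def Q_def by (intro product_nn_integral_prod) (auto simp: J_def)
  have "emeasure lborel {z. ennreal s < H z} = (\<integral>\<^sup>+z. indicator {z. ennreal s < H z} z \<partial>lborel)"
    by simp
  also have "\<dots> = (\<integral>\<^sup>+y. \<integral>\<^sup>+x. indicator {z. ennreal s < H z} (vec_split j y x) \<partial>lborel \<partial>Q)"
    unfolding Q_def J_def by (rule nn_integral_vec_split) measurable
  also have "\<dots> = (\<integral>\<^sup>+y. emeasure lborel {x. ennreal s <
      (\<integral>\<^sup>+x'. kern x x' * (\<integral>\<^sup>+y'. K y y' * G (vec_split j y' x') \<partial>Q) \<partial>lborel)} \<partial>Q)"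
  \<comment> \<open>By \<open>H_split\<close>, a fibre of the superlevel set of \<open>H\<close> is
    a superlevel set of the one-variable operator.\<close>
  proof (rule nn_integral_cong)
    fix y assume y: "y \<in> space Q"
    have [measurable]: "(\<lambda>x. vec_split j y x) \<in> borel_measurable lborel"
      using measurable_compose[OF _ v, of "\<lambda>x. (y, x)" lborel] y by simp
    have [measurable]: "{x. ennreal s < H (vec_split j y x)} \<in> sets borel"
      by measurable
    have "(\<integral>\<^sup>+x. indicator {z. ennreal s < H z} (vec_split j y x) \<partial>lborel)
        = (\<integral>\<^sup>+x. indicator {x. ennreal s < H (vec_split j y x)} x \<partial>lborel)"
      by (intro nn_integral_cong) (simp split: split_indicator)
    also have "\<dots> = emeasure lborel {x. ennreal s < H (vec_split j y x)}"
      by simp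
    finally show "(\<integral>\<^sup>+x. indicator {z. ennreal s < H z} (vec_split j y x) \<partial>lborel)
      = emeasure lborel {x. ennreal s <
      (\<integral>\<^sup>+x'. kern x x' * (\<integral>\<^sup>+y'. K y y' * G (vec_split j y' x') \<partial>Q) \<partial>lborel)}"
      by (simp only: H_split[OF y])
  qed
  also have "\<dots> \<le> ennreal (102400 / s) *
      (\<integral>\<^sup>+x'. \<integral>\<^sup>+y'. (\<integral>\<^sup>+y. K y y' \<partial>Q) * G (vec_split j y' x') \<partial>Q \<partial>lborel)"
    by (rule weak_type_kern_fibred[OF Q K Gv s])
  also have "(\<integral>\<^sup>+x'. \<integral>\<^sup>+y'. (\<integral>\<^sup>+y. K y y' \<partial>Q) * G (vec_split j y' x') \<partial>Q \<partial>lborel)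
      = (\<integral>\<^sup>+x'. \<integral>\<^sup>+y'. (\<Prod>i\<in>J. \<integral>\<^sup>+z. kern z (y' i) \<partial>lborel) * G (vec_split j y' x') \<partial>Q \<partial>lborel)"
    by (simp only: K_int)
  also have "(\<integral>\<^sup>+x'. \<integral>\<^sup>+y'. (\<Prod>i\<in>J. \<integral>\<^sup>+z. kern z (y' i) \<partial>lborel) * G (vec_split j y' x') \<partial>Q \<partial>lborel)
      = (\<integral>\<^sup>+w. (\<Prod>i\<in>J. \<integral>\<^sup>+z. kern z (w $ i) \<partial>lborel) * G w \<partial>lborel)"
  proof (subst nn_integral_vec_split(2)[where j = j])
    have "(\<Prod>i\<in>J. \<integral>\<^sup>+z. kern z (vec_split j y x $ i) \<partial>lborel) = (\<Prod>i\<in>J. \<integral>\<^sup>+z. kern z (y i) \<partial>lborel)" for y x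
      by (intro prod.cong) (auto simp: J_def vec_split_def)
    then show "(\<integral>\<^sup>+x'. \<integral>\<^sup>+y'. (\<Prod>i\<in>J. \<integral>\<^sup>+z. kern z (y' i) \<partial>lborel) * G (vec_split j y' x') \<partial>Q \<partial>lborel)
      = (\<integral>\<^sup>+x'. \<integral>\<^sup>+y'. (\<Prod>i\<in>J. \<integral>\<^sup>+z. kern z (vec_split j y' x' $ i) \<partial>lborel) * G (vec_split j y' x')
          \<partial>(\<Pi>\<^sub>M i\<in>UNIV - {j}. lborel) \<partial>lborel)"
      by (simp add: Q_def J_def)
  qed measurable
  finally show ?thesis
    unfolding H_def J_def .
qed

text \<open>The \<open>k\<close> kernel integrals are each at most \<open>64 * M\<close> for a
  common \<open>M\<close>, so Young's inequality splits \<open>g w * M ^ k\<close> into the Young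
  function, whose integral is at most 1, and \<open>2 ^ M\<close>, whose integral is a product of
  one-variable integrals. The base 256 is \<open>64 * 4\<close>.\<close>

lemma LlogL_duality:
  fixes g :: "complex ^ 'n \<Rightarrow> real" and j :: 'n
  defines "k \<equiv> CARD('n) - 1"
  assumes [measurable]: "g \<in> borel_measurable borel"
    and g: "\<And>w. 0 \<le> g w" "\<And>w. w \<notin> polydisc \<Longrightarrow> g w = 0"
    and le1: "(\<integral>\<^sup>+w. ennreal (Phi_LlogL k (g w)) \<partial>lborel) \<le> 1"
  shows "(\<integral>\<^sup>+w. (\<Prod>i\<in>UNIV - {j}. \<integral>\<^sup>+z. kern z (w $ i) \<partial>lborel) * ennreal (g w) \<partial>lborel)
    \<le> ennreal (256 ^ k * (1 + fact k * 12288 ^ CARD('n)))"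
proof -
  define b where "b w = ennreal (2 ^ scale_count w) * indicator (ball 0 1) w" for w
  have [measurable]: "b \<in> borel_measurable borel"
    unfolding b_def by (intro borel_measurable_times_ennreal borel_measurable_indicator) auto
  have Phi: "0 \<le> Phi_LlogL k (g w)" for w
    using g(1) by (simp add: Phi_LlogL_def log_plus_def)
  have [measurable]: "log_plus \<in> borel_measurable borel" "Phi_LlogL k \<in> borel_measurable borel"
    unfolding log_plus_def Phi_LlogL_def by measurable
  have k: "card (UNIV - {j}) = k" by (simp add: k_def)
  have "(\<integral>\<^sup>+w. (\<Prod>i\<in>UNIV - {j}. \<integral>\<^sup>+z. kern z (w $ i) \<partial>lborel) * ennreal (g w) \<partial>lborel)
    \<le> (\<integral>\<^sup>+w. ennreal (256 ^ k) * (ennreal (Phi_LlogL k (g w)) + ennreal (fact k) * (\<Prod>i\<in>UNIV. b (w $ i))) \<partial>lborel)"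
  proof (rule nn_integral_mono)
    fix w :: "complex ^ 'n"
    show "(\<Prod>i\<in>UNIV - {j}. \<integral>\<^sup>+z. kern z (w $ i) \<partial>lborel) * ennreal (g w)
      \<le> ennreal (256 ^ k) * (ennreal (Phi_LlogL k (g w)) + ennreal (fact k) * (\<Prod>i\<in>UNIV. b (w $ i)))"
    proof (cases "w \<in> polydisc")
      case True
      then have w: "norm (w $ i) < 1" for i by (simp add: polydisc_def)
      \<comment> \<open>The sum includes coordinate \<open>j\<close>: it dominates every single
        count, and \<open>2 ^ M\<close> factors over all coordinates, so that it can be integrated
        over the whole polydisc.\<close>
      define M where "M = (\<Sum>i\<in>UNIV. scale_count (w $ i))"
      have "(\<Prod>i\<in>UNIV - {j}. \<integral>\<^sup>+z. kern z (w $ i) \<partial>lborel) \<le> (\<Prod>i\<in>UNIV - {j}. ennreal (64 * real M))"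
      proof (rule prod_mono_ennreal)
        fix i
        have "scale_count (w $ i) \<le> M"
          unfolding M_def by (rule member_le_sum) auto
        then show "(\<integral>\<^sup>+z. kern z (w $ i) \<partial>lborel) \<le> ennreal (64 * real M)"
          by (intro order_trans[OF nn_integral_kern_le[OF w]] ennreal_leI) simp
      qed
      also have "\<dots> = ennreal ((64 * real M) ^ k)"
        unfolding prod_constant k by (simp add: ennreal_power)
      finally have "(\<Prod>i\<in>UNIV - {j}. \<integral>\<^sup>+z. kern z (w $ i) \<partial>lborel) * ennreal (g w)
          \<le> ennreal ((64 * real M) ^ k) * ennreal (g w)"
        by (rule mult_right_mono) simp
      also have "\<dots> = ennreal (64 ^ k * (g w * real M ^ k))"
        using g(1) by (simp add: power_mult_distrib mult_ac flip: ennreal_mult)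
      also have "\<dots> \<le> ennreal (64 ^ k * (4 ^ k * Phi_LlogL k (g w) + 4 ^ k * fact k * 2 powr M))"
        using g(1) by (intro ennreal_leI mult_left_mono mult_power_le_Phi_LlogL) auto
      also have "64 ^ k * (4 ^ k * Phi_LlogL k (g w) + 4 ^ k * fact k * 2 powr M)
          = 256 ^ k * (Phi_LlogL k (g w) + fact k * 2 ^ M)"
      proof -
        have "(256::real) ^ k = 64 ^ k * 4 ^ k" by (simp flip: power_mult_distrib)
        then show ?thesis by (simp add: powr_realpow algebra_simps)
      qed
      also have "ennreal \<dots> = ennreal (256 ^ k) * (ennreal (Phi_LlogL k (g w)) + ennreal (fact k) * ennreal (2 ^ M))"
        using Phi[of w] by (simp add: ennreal_mult ennreal_plus)
      also have "ennreal (2 ^ M) = (\<Prod>i\<in>UNIV. b (w $ i))"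
        using w by (simp add: b_def M_def power_sum prod_ennreal)
      finally show ?thesis .
    qed (simp add: g)
  qed
  also have "\<dots> = ennreal (256 ^ k) * ((\<integral>\<^sup>+w. ennreal (Phi_LlogL k (g w)) \<partial>lborel)
      + ennreal (fact k) * (\<integral>\<^sup>+w. (\<Prod>i\<in>(UNIV :: 'n set). b (w $ i)) \<partial>lborel))"
    by (simp add: nn_integral_cmult nn_integral_add)
  also have "\<dots> \<le> ennreal (256 ^ k) * (1 + ennreal (fact k) * ennreal 12288 ^ CARD('n))"
    unfolding nn_integral_lborel_vec_prod[OF \<open>b \<in> borel_measurable borel\<close>]
    using nn_integral_two_power_scale_count_le unfolding b_def[symmetric]
    by (intro mult_left_mono add_mono le1 power_mono) auto
  also have "\<dots> = ennreal (256 ^ k * (1 + fact k * 12288 ^ CARD('n)))"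
    by (simp add: ennreal_mult ennreal_plus ennreal_power del: ennreal_numeral ennreal_fact)
  finally show ?thesis .
qed

section \<open>From the Bergman projection to the positive operator\<close>

lemma polydisc_sets [measurable]: "polydisc \<in> sets borel"
  unfolding polydisc_def by measurable

text \<open>Each factor 1/pi is at most 1 and is discarded.\<close>

lemma norm_bergman_integrand_le:
  fixes z w :: "complex ^ 'n"
  assumes "z \<in> polydisc" "w \<in> polydisc"
  shows "ennreal (norm ((\<Prod>j\<in>UNIV. 1 / (complex_of_real pi * (1 - z $ j * cnj (w $ j))^2)) * c))
    \<le> (\<Prod>j\<in>UNIV. kern (z $ j) (w $ j)) * ennreal (norm c)"
proof -
  have "norm ((\<Prod>j\<in>UNIV. 1 / (complex_of_real pi * (1 - z $ j * cnj (w $ j))^2)) * c)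
      = (\<Prod>j\<in>UNIV. 1 / (pi * (norm (1 - z $ j * cnj (w $ j)))\<^sup>2)) * norm c"
    by (simp add: norm_mult norm_divide norm_power flip: prod_norm)
  also have "\<dots> \<le> (\<Prod>j\<in>UNIV. 1 / (norm (1 - z $ j * cnj (w $ j)))\<^sup>2) * norm c"
  proof (intro mult_right_mono prod_mono conjI)
    fix j
    show "1 / (pi * (norm (1 - z $ j * cnj (w $ j)))\<^sup>2) \<le> 1 / (norm (1 - z $ j * cnj (w $ j)))\<^sup>2"
      using pi_gt3 by (simp add: divide_simps mult_left_mono)
  qed auto
  finally show ?thesis
    using assms
    by (simp add: polydisc_def kern_def prod_ennreal prod_nonneg ennreal_leI flip: ennreal_mult)
qed

text \<open>The positive operator is applied to a Borel version of \<open>norm (f w) / l\<close>,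
  whose modular is at most 1. By homogeneity the level becomes \<open>s / l\<close>, which produces
  the factor \<open>l\<close> in the bound.\<close>

lemma bergman_weak_type_modular:
  fixes f :: "complex ^ 'n \<Rightarrow> complex"
  defines "k \<equiv> CARD('n) - 1"
  assumes f: "set_borel_measurable lebesgue polydisc f"
    and l: "l > 0" and mod: "LlogL_modular k polydisc f l \<le> 1" and s: "s > 0"
  shows "emeasure lebesgue {z \<in> polydisc. norm (bergman_proj f z) > s}
    \<le> ennreal (102400 * (256 ^ k * (1 + fact k * 12288 ^ CARD('n))) * l / s)"
proof -
  define u where "u w = indicator polydisc w * (norm (f w) / l)" for w
  have "(\<lambda>w. norm (indicator polydisc w *\<^sub>R f w) / l) \<in> borel_measurable lebesgue"
    using f unfolding set_borel_measurable_def by measurable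
  then have "u \<in> borel_measurable lebesgue"
    by (simp add: u_def[abs_def])
  then obtain g0 where [measurable]: "g0 \<in> borel_measurable lborel" and g0: "AE w in lborel. u w = g0 w"
    using completion_ex_borel_measurable_real by blast
  \<comment> \<open>\<open>g0\<close> agrees with \<open>u\<close> only almost everywhere.
    Truncation and cutoff make nonnegativity and vanishing off the polydisc hold at every point, as
    \<open>LlogL_duality\<close> demands.\<close>
  define g where "g w = indicator polydisc w * max 0 (g0 w)" for w
  have g_meas [measurable]: "g \<in> borel_measurable borel"
    unfolding g_def by measurable
  have ae: "AE w in lborel. g w = u w"
    using g0
  proof eventually_elim
    fix w assume "u w = g0 w"
    moreover have "0 \<le> u w" using l by (simp add: u_def)
    ultimately show "g w = u w" by (auto simp: g_def u_def split: split_indicator)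
  qed
  have "(\<integral>\<^sup>+w. ennreal (Phi_LlogL k (g w)) \<partial>lborel) = LlogL_modular k polydisc f l"
    unfolding LlogL_modular_def nn_integral_completion
    by (rule nn_integral_cong_AE, use ae in eventually_elim)
       (auto simp: u_def Phi_LlogL_def split: split_indicator)
  then have le1: "(\<integral>\<^sup>+w. ennreal (Phi_LlogL k (g w)) \<partial>lborel) \<le> 1"
    using mod by simp
  define T where "T z = (\<integral>\<^sup>+w. (\<Prod>i\<in>UNIV. kern (z $ i) (w $ i)) * ennreal (g w) \<partial>lborel)" for z
  have [measurable]: "T \<in> borel_measurable borel"
    unfolding T_def by measurable
  have bergman_le: "ennreal (norm (bergman_proj f z)) \<le> ennreal l * T z" if z: "z \<in> polydisc" for z
  proof -
    define F where "F w = indicator polydisc w *\<^sub>R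
      ((\<Prod>j\<in>UNIV. 1 / (complex_of_real pi * (1 - z $ j * cnj (w $ j))^2)) * f w)" for w
    have "ennreal (norm (bergman_proj f z)) \<le> (\<integral>\<^sup>+w. ennreal (norm (F w)) \<partial>lebesgue)"
    proof (cases "integrable lebesgue F")
      case True
      then show ?thesis
        unfolding bergman_proj_def set_lebesgue_integral_def F_def[symmetric]
        by (rule integral_norm_bound_ennreal)
    next
      \<comment> \<open>The Bochner integral of a non-integrable function is 0 by convention, so the
        bound is trivial.\<close>
      case False
      then show ?thesis
        unfolding bergman_proj_def set_lebesgue_integral_def F_def[symmetric]
        by (simp add: not_integrable_integral_eq)
    qed
    also have "\<dots> \<le> (\<integral>\<^sup>+w. ennreal l * ((\<Prod>i\<in>UNIV. kern (z $ i) (w $ i)) * ennreal (g w)) \<partial>lborel)"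
      unfolding nn_integral_completion
    proof (rule nn_integral_mono_AE, use ae in eventually_elim)
      fix w assume gu: "g w = u w"
      show "ennreal (norm (F w)) \<le> ennreal l * ((\<Prod>i\<in>UNIV. kern (z $ i) (w $ i)) * ennreal (g w))"
      proof (cases "w \<in> polydisc")
        case True
        have "ennreal (norm (f w)) = ennreal l * ennreal (g w)"
          using True l by (simp add: gu u_def flip: ennreal_mult)
        then show ?thesis
          using norm_bergman_integrand_le[OF z True, of "f w"] True by (simp add: F_def mult_ac)
      qed (simp add: F_def)
    qed
    also have "\<dots> = ennreal l * T z"
      unfolding T_def by (rule nn_integral_cmult) measurable
    finally show ?thesis .
  qed
  have "{z \<in> polydisc. norm (bergman_proj f z) > s} \<subseteq> {z. ennreal (s / l) < T z}"
  proof safe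
    fix z :: "complex ^ 'n" assume z: "z \<in> polydisc" and large: "norm (bergman_proj f z) > s"
    show "ennreal (s / l) < T z"
    proof (rule ccontr)
      assume "\<not> ?thesis"
      then have "ennreal l * T z \<le> ennreal l * ennreal (s / l)"
        by (intro mult_left_mono) auto
      also have "\<dots> = ennreal s"
        using l s by (simp flip: ennreal_mult)
      finally have "ennreal (norm (bergman_proj f z)) \<le> ennreal s"
        using bergman_le[OF z] by (rule order_trans[rotated])
      then show False using large s by (simp add: ennreal_le_iff)
    qed
  qed
  then have "emeasure lebesgue {z \<in> polydisc. norm (bergman_proj f z) > s}
      \<le> emeasure lebesgue {z. ennreal (s / l) < T z}"
    by (intro emeasure_mono) auto
  also have "\<dots> = emeasure lborel {z. ennreal (s / l) < T z}"
    by simp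
  \<comment> \<open>Any coordinate may be singled out; \<open>undefined\<close> names one.\<close>
  also have "\<dots> \<le> ennreal (102400 / (s / l)) *
      (\<integral>\<^sup>+w. (\<Prod>i\<in>UNIV - {undefined}. \<integral>\<^sup>+z. kern z (w $ i) \<partial>lborel) * ennreal (g w) \<partial>lborel)"
    unfolding T_def using l s by (intro weak_type_kern_vec) auto
  also have "\<dots> \<le> ennreal (102400 / (s / l)) * ennreal (256 ^ k * (1 + fact k * 12288 ^ CARD('n)))"
    unfolding k_def using le1
    by (intro mult_left_mono LlogL_duality g_meas) (auto simp: g_def k_def)
  also have "\<dots> = ennreal (102400 / (s / l) * (256 ^ k * (1 + fact k * 12288 ^ CARD('n))))"
    using l s by (intro ennreal_mult[symmetric]) auto
  also have "102400 / (s / l) * (256 ^ k * (1 + fact k * 12288 ^ CARD('n)))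
      = 102400 * (256 ^ k * (1 + fact k * 12288 ^ CARD('n))) * l / s"
    by simp
  finally show ?thesis .
qed

theorem theorem3p7:
  "\<exists>C>0. \<forall>(f :: complex ^ 'n \<Rightarrow> complex) (lam :: real).
      f \<in> LlogL_space (CARD('n) - 1) (polydisc :: (complex ^ 'n) set) \<longrightarrow> lam > 0 \<longrightarrow>
      emeasure lebesgue {z \<in> (polydisc :: (complex ^ 'n) set). norm (bergman_proj f z) > lam}
        \<le> ennreal (C * LlogL_norm (CARD('n) - 1) (polydisc :: (complex ^ 'n) set) f / lam)"
proof -
  define k where "k = CARD('n) - 1"
  define C :: real where "C = 102400 * (256 ^ k * (1 + fact k * 12288 ^ CARD('n)))"
  have C: "C > 0"
    unfolding C_def by (intro mult_pos_pos add_pos_pos zero_less_power) auto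
  have "emeasure lebesgue {z \<in> polydisc. norm (bergman_proj f z) > s}
      \<le> ennreal (C * LlogL_norm k polydisc f / s)"
    if f: "f \<in> LlogL_space k polydisc" and s: "s > 0" for f :: "complex ^ 'n \<Rightarrow> complex" and s
  proof -
    define L where "L = {l. l > 0 \<and> LlogL_modular k polydisc f l \<le> 1}"
    define m where "m = emeasure lebesgue {z \<in> polydisc. norm (bergman_proj f z) > s}"
    have ne: "L \<noteq> {}" and meas: "set_borel_measurable lebesgue polydisc f"
      using f by (auto simp: LlogL_space_def L_def)
    have m_le: "m \<le> ennreal (C * l / s)" if "l \<in> L" for l
      using bergman_weak_type_modular[OF meas, of l s] that s
      by (simp add: L_def m_def C_def k_def)
    \<comment> \<open>\<open>L\<close> is nonempty, so one of the bounds already makes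
      \<open>m\<close> finite, and the infimum can be handled in the reals.\<close>
    then obtain r where r: "r \<ge> 0" "m = ennreal r"
      using ne by (metis ennreal_cases ennreal_less_top ex_in_conv leD)
    \<comment> \<open>Solved for \<open>l\<close>, the estimates say that \<open>r * s / C\<close>
      is a lower bound of \<open>L\<close>. Hence they pass to the Luxemburg norm, whether or not
      the infimum is attained.\<close>
    have "r * s / C \<le> Inf L"
    proof (rule cInf_greatest[OF ne])
      fix l assume l: "l \<in> L"
      then have "r \<le> C * l / s"
        using m_le[OF l] r C s by (auto simp: L_def ennreal_le_iff)
      then show "r * s / C \<le> l"
        using C s by (simp add: field_simps)
    qed
    then have "r \<le> C * Inf L / s"
      using C s by (simp add: field_simps)
    then show ?thesis
      using r by (simp add: m_def L_def LlogL_norm_def ennreal_leI)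
  qed
  with C show ?thesis
    unfolding k_def by blast
qed

end
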